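(* Let $\mathbb{A}$ be a finite alphabet, $m\ge 1$ an integer, and $\sigma:\mathbb{A}^*\to\mathbb{A}^*$ a primitive $m$-uniform substitution having an aperiodic fixed point $x\in\mathbb{A}^{\mathbb{N}}$. Then there exists a constant $C=C(\sigma)$ such that for every $y\in X(\sigma)$ and all integers $n\ge 0$, $k\ge 1$, the word $y$ contains a $k$-anti-power with block length at most $Ck$ starting at position $n$; that is, there is an integer $L$ with $1\le L\le Ck$ such that the $k$ words $y_{[n+sL,\,n+(s+1)L-1]}$, $0\le s\le k-1$, are pairwise distinct.
   Context: Infinite words are indexed from $0$: $y=y_0y_1y_2\cdots$, and $y_{[p,q]}=y_py_{p+1}\cdots y_q$. A substitution is a morphism $\sigma:\mathbb{A}^*\to\mathbb{A}^*$ (so $\sigma(uv)=\sigma(u)\sigma(v)$); it is $m$-uniform if $|\sigma(a)|=m$ for every letter $a\in\mathbb{A}$, and primitive if there exists $n$ such that for all letters $a,b\in\mathbb{A}$, $b$ occurs in $\sigma^n(a)$. A fixed point of $\sigma$ is an infinite word $x$ with $\sigma(x)=x$; aperiodic means not eventually periodic. For a fixed point $x$, $X(x)$ denotes the closure (in the product topology on $\mathbb{A}^{\mathbb{N}}$) of the orbit $\{\tau^j(x): j\ge 0\}$ under the shift $\tau(a_0a_1a_2\cdots)=a_1a_2\cdots$; for primitive $\sigma$ this set does not depend on the chosen fixed point and is denoted $X(\sigma)$. A $k$-anti-power is a word that is a concatenation of $k$ blocks of the same length which are pairwise distinct; that common length is its block length. *)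

theory Defs
  imports "HOL-Analysis.Analysis" "HOL-Library.Omega_Words_Fun"
begin

(* Finite words over the alphabet 'a are lists, infinite words have type 'a word = nat => 'a.
   subsequence w i j is the half-open factor w_i ... w_(j-1). *)

section \<open>Substitutions\<close>

definition substitution :: "('a list \<Rightarrow> 'a list) \<Rightarrow> bool" where
  "substitution \<sigma> \<longleftrightarrow> (\<forall>u v. \<sigma> (u @ v) = \<sigma> u @ \<sigma> v)"

definition uniform_subst :: "nat \<Rightarrow> ('a list \<Rightarrow> 'a list) \<Rightarrow> bool" where
  "uniform_subst m \<sigma> \<longleftrightarrow> (\<forall>a. length (\<sigma> [a]) = m)"

definition primitive_subst :: "('a list \<Rightarrow> 'a list) \<Rightarrow> bool" where
  "primitive_subst \<sigma> \<longleftrightarrow> (\<exists>n. \<forall>a b. b \<in> set ((\<sigma> ^^ n) [a]))"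

(* The action on infinite words, \<sigma>(x_0) \<sigma>(x_1) \<sigma>(x_2) ...  This is meant for substitutions that
   erase no letter: then \<sigma>(x_0 ... x_i) has more than i letters, so its i-th letter exists, and it
   is the i-th letter of the infinite concatenation; see prefix_subst_word below. *)
definition subst_word :: "('a list \<Rightarrow> 'a list) \<Rightarrow> 'a word \<Rightarrow> 'a word" where
  "subst_word \<sigma> x = (\<lambda>i. \<sigma> (prefix (Suc i) x) ! i)"

definition fixed_point :: "('a list \<Rightarrow> 'a list) \<Rightarrow> 'a word \<Rightarrow> bool" where
  "fixed_point \<sigma> x \<longleftrightarrow> subst_word \<sigma> x = x"

definition eventually_periodic :: "'a word \<Rightarrow> bool" where
  "eventually_periodic x \<longleftrightarrow> (\<exists>N p. p \<ge> 1 \<and> (\<forall>i\<ge>N. x (i + p) = x i))"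

definition aperiodic :: "'a word \<Rightarrow> bool" where
  "aperiodic x \<longleftrightarrow> \<not> eventually_periodic x"


section \<open>Subshifts\<close>

definition word_topology :: "'a word topology" where
  "word_topology = product_topology (\<lambda>_. discrete_topology UNIV) UNIV"

definition orbit_closure :: "'a word \<Rightarrow> 'a word set" where
  "orbit_closure x = word_topology closure_of {suffix j x | j. True}"

(* The choice of the fixed point is immaterial for primitive substitutions;
   see subshift_eq_orbit_closure below. *)
definition subshift :: "('a list \<Rightarrow> 'a list) \<Rightarrow> 'a word set" where
  "subshift \<sigma> = orbit_closure (SOME x. fixed_point \<sigma> x)"


section \<open>Anti-powers\<close>

definition anti_power :: "nat \<Rightarrow> nat \<Rightarrow> 'a list \<Rightarrow> bool" where
  "anti_power k L w \<longleftrightarrow>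
     (\<exists>bs. length bs = k \<and> (\<forall>b\<in>set bs. length b = L) \<and> distinct bs \<and> w = concat bs)"


section \<open>Consistency of the definitions\<close>

lemma substitution_Nil: "substitution \<sigma> \<Longrightarrow> \<sigma> [] = []"
  unfolding substitution_def by (metis append_Nil append_self_conv)

lemma substitution_funpow: "substitution \<sigma> \<Longrightarrow> substitution (\<sigma> ^^ n)"
  by (induction n) (auto simp: substitution_def)

lemma length_uniform_subst:
  assumes "substitution \<sigma>" "uniform_subst m \<sigma>"
  shows "length (\<sigma> u) = m * length u"
proof (induction u)
  case Nil
  then show ?case using substitution_Nil[OF assms(1)] by simp
next
  case (Cons a u)
  have "\<sigma> (a # u) = \<sigma> [a] @ \<sigma> u"
    using assms(1) unfolding substitution_def by (metis append_Cons append_Nil)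
  then show ?case using Cons assms(2) by (simp add: uniform_subst_def)
qed

lemma length_uniform_subst_funpow:
  assumes "substitution \<sigma>" "uniform_subst m \<sigma>"
  shows "length ((\<sigma> ^^ n) u) = m ^ n * length u"
  by (induction n) (auto simp: length_uniform_subst[OF assms])

lemma prefix_subst_word:
  assumes s: "substitution \<sigma>" and u: "uniform_subst m \<sigma>" and m: "m \<ge> 1"
  shows "prefix (m * n) (subst_word \<sigma> x) = \<sigma> (prefix n x)"
proof (rule nth_equalityI)
  show "length (prefix (m * n) (subst_word \<sigma> x)) = length (\<sigma> (prefix n x))"
    by (simp add: length_uniform_subst[OF s u])
next
  fix i assume "i < length (prefix (m * n) (subst_word \<sigma> x))"
  then have i: "i < m * n" by simp
  have mono: "\<sigma> (prefix q x) ! i = \<sigma> (prefix p x) ! i" if "p \<le> q" "i < m * p" for p q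
  proof -
    have "prefix q x = prefix p x @ subsequence x p q"
      using subsequence_append[where i = p and j = "q - p" and w = x] that by simp
    then have "\<sigma> (prefix q x) = \<sigma> (prefix p x) @ \<sigma> (subsequence x p q)"
      using s by (simp add: substitution_def)
    then show ?thesis using that by (simp add: nth_append length_uniform_subst[OF s u])
  qed
  have "i < m * Suc i"
    using m by (metis lessI less_le_trans mult_1 mult_le_mono1)
  then have "\<sigma> (prefix (Suc i) x) ! i = \<sigma> (prefix n x) ! i"
    using mono[of n "Suc i"] mono[of "Suc i" n] i by (cases "n \<le> Suc i") auto
  then show "prefix (m * n) (subst_word \<sigma> x) ! i = \<sigma> (prefix n x) ! i"
    using i by (simp add: subst_word_def)
qed

lemma fixed_point_prefix:
  assumes "substitution \<sigma>" "uniform_subst m \<sigma>" "m \<ge> 1" "fixed_point \<sigma> x"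
  shows "(\<sigma> ^^ k) (prefix n x) = prefix (m ^ k * n) x"
proof (induction k)
  case (Suc k)
  then show ?case
    using prefix_subst_word[OF assms(1-3), where n = "m ^ k * n" and x = x] assms(4)
    by (simp add: fixed_point_def mult.assoc)
qed simp

lemma in_orbit_closure_iff:
  "y \<in> orbit_closure x \<longleftrightarrow> (\<forall>n. \<exists>j. prefix n y = subsequence x j (j + n))"
proof
  assume y: "y \<in> orbit_closure x"
  show "\<forall>n. \<exists>j. prefix n y = subsequence x j (j + n)"
  proof
    fix n
    define U where "U = (\<lambda>i. if i < n then {y i} else (UNIV :: 'a set))"
    have "{i. U i \<noteq> UNIV} \<subseteq> {..<n}" by (auto simp: U_def split: if_splits)
    then have fin: "finite {i. U i \<noteq> UNIV}" by (rule finite_subset) simp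
    have "openin word_topology (Pi\<^sub>E UNIV U)"
      unfolding word_topology_def openin_product_topology_alt
      using fin by auto
    moreover have "y \<in> Pi\<^sub>E UNIV U" by (auto simp: U_def)
    ultimately obtain z where "z \<in> {suffix j x | j. True}" and z: "z \<in> Pi\<^sub>E UNIV U"
      using y unfolding orbit_closure_def in_closure_of by blast
    then obtain j where zj: "z = suffix j x" by blast
    have "x (j + i) = y i" if "i < n" for i
    proof -
      have "z i \<in> U i" using z by auto
      then show ?thesis using that by (simp add: U_def zj)
    qed
    then have "prefix n y = subsequence x j (j + n)" by (intro nth_equalityI) auto
    then show "\<exists>j. prefix n y = subsequence x j (j + n)" ..
  qed
next
  assume *: "\<forall>n. \<exists>j. prefix n y = subsequence x j (j + n)"
  show "y \<in> orbit_closure x"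
    unfolding orbit_closure_def in_closure_of
  proof (intro conjI allI impI)
    show "y \<in> topspace word_topology" by (simp add: word_topology_def)
  next
    fix T assume "y \<in> T \<and> openin word_topology T"
    then obtain U where fin: "finite {i. U i \<noteq> (UNIV :: 'a set)}"
      and yU: "y \<in> Pi\<^sub>E UNIV U" and UT: "Pi\<^sub>E UNIV U \<subseteq> T"
      unfolding word_topology_def openin_product_topology_alt by auto
    obtain n where n: "\<And>i. U i \<noteq> UNIV \<Longrightarrow> i < n"
      using fin unfolding finite_nat_set_iff_bounded by auto
    obtain j where j: "prefix n y = subsequence x j (j + n)" using * by blast
    have eq: "x (j + i) = y i" if "i < n" for i
      using arg_cong[OF j, of "\<lambda>w. w ! i"] that by simp
    have "suffix j x \<in> Pi\<^sub>E UNIV U"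
    proof (rule PiE_I)
      fix i show "suffix j x i \<in> U i"
      proof (cases "U i = UNIV")
        case False
        have "y i \<in> U i" using yU by auto
        then show ?thesis using eq[OF n[OF False]] by simp
      qed simp
    qed simp
    then show "\<exists>z. z \<in> {suffix j x | j. True} \<and> z \<in> T" using UT by blast
  qed
qed

lemma orbit_closure_fixed_point_subset:
  assumes s: "substitution \<sigma>" and u: "uniform_subst m \<sigma>" and m: "m \<ge> 1"
    and p: "primitive_subst \<sigma>" and x: "fixed_point \<sigma> x" and z: "fixed_point \<sigma> z"
  shows "orbit_closure x \<subseteq> orbit_closure z"
proof
  obtain N where N: "\<And>a b. b \<in> set ((\<sigma> ^^ N) [a])"
    using p unfolding primitive_subst_def by blast
  have factor: "\<exists>j. prefix (m ^ k) x = subsequence z j (j + m ^ k)" for k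
  proof -
    obtain v w where vw: "(\<sigma> ^^ N) [z 0] = v @ [x 0] @ w"
      using split_list[OF N[of "x 0" "z 0"]] by auto
    have sk: "substitution (\<sigma> ^^ k)" by (rule substitution_funpow[OF s])
    have px: "(\<sigma> ^^ k) [x 0] = prefix (m ^ k) x"
      using fixed_point_prefix[OF s u m x, where k = k and n = 1] by simp
    have "prefix (m ^ (k + N)) z = (\<sigma> ^^ (k + N)) [z 0]"
      using fixed_point_prefix[OF s u m z, where k = "k + N" and n = 1] by simp
    also have "\<dots> = (\<sigma> ^^ k) (v @ [x 0] @ w)" by (simp only: funpow_add comp_apply vw)
    also have "\<dots> = (\<sigma> ^^ k) v @ prefix (m ^ k) x @ (\<sigma> ^^ k) w"
      using sk px by (simp only: substitution_def)
    finally have eq: "prefix (m ^ (k + N)) z = (\<sigma> ^^ k) v @ prefix (m ^ k) x @ (\<sigma> ^^ k) w" .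
    define j where "j = length ((\<sigma> ^^ k) v)"
    have len: "j + m ^ k \<le> m ^ (k + N)"
      using arg_cong[OF eq, of length] by (simp add: j_def)
    have "prefix (m ^ k) x = take (m ^ k) (drop j (prefix (m ^ (k + N)) z))"
      unfolding eq by (simp add: j_def del: subsequence_take subsequence_drop)
    also have "\<dots> = subsequence z j (j + m ^ k)" using len by (simp add: min_def)
    finally show ?thesis by blast
  qed
  fix y assume "y \<in> orbit_closure x"
  then have y: "\<forall>n. \<exists>j. prefix n y = subsequence x j (j + n)" by (simp add: in_orbit_closure_iff)
  show "y \<in> orbit_closure z"
  proof (cases "m = 1")
    case True
    then have "length ((\<sigma> ^^ N) [a]) = 1" for a
      by (simp add: length_uniform_subst_funpow[OF s u])
    then have "\<exists>c. (\<sigma> ^^ N) [a] = [c]" for a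
      by (metis One_nat_def length_0_conv length_Suc_conv)
    then have one: "b = c" for b c :: 'a
      using N by (metis empty_iff insert_iff list.simps(15) set_empty)
    have "y = z" by (rule ext) (rule one)
    then show ?thesis
      unfolding in_orbit_closure_iff by (intro allI exI[of _ 0]) simp
  next
    case False
    then have m2: "2 \<le> m" using m by simp
    show ?thesis unfolding in_orbit_closure_iff
    proof
      fix n
      obtain j where j: "prefix n y = subsequence x j (j + n)" using y by blast
      define k where "k = j + n"
      have "k < 2 ^ k" by (rule less_exp)
      also have "(2 :: nat) ^ k \<le> m ^ k" by (rule power_mono[OF m2]) simp
      finally have k: "k \<le> m ^ k" by simp
      obtain i where i: "prefix (m ^ k) x = subsequence z i (i + m ^ k)" using factor by blast
      have "z (i + q) = x q" if "q < m ^ k" for q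
        using arg_cong[OF i, of "\<lambda>w. w ! q"] that by simp
      then have "subsequence x j (j + n) = subsequence z (i + j) (i + j + n)"
        using k by (intro nth_equalityI) (auto simp: k_def add.assoc)
      then have "prefix n y = subsequence z (i + j) (i + j + n)" by (simp only: j)
      then show "\<exists>j. prefix n y = subsequence z j (j + n)" ..
    qed
  qed
qed

lemma subshift_eq_orbit_closure:
  assumes "substitution \<sigma>" "uniform_subst m \<sigma>" "m \<ge> 1" "primitive_subst \<sigma>" "fixed_point \<sigma> x"
  shows "subshift \<sigma> = orbit_closure x"
proof -
  have "fixed_point \<sigma> (SOME x. fixed_point \<sigma> x)" using assms(5) by (rule someI[of "fixed_point \<sigma>"])
  then show ?thesis
    unfolding subshift_def
    using orbit_closure_fixed_point_subset[OF assms(1-4)] assms(5) by blast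
qed

lemma anti_power_factor_iff:
  "anti_power k L (subsequence y n (n + k * L)) \<longleftrightarrow>
     inj_on (\<lambda>s. subsequence y (n + s * L) (n + (s + 1) * L)) {..<k}"
proof -
  define B where "B = map (\<lambda>s. subsequence y (n + s * L) (n + (s + 1) * L)) [0..<k]"
  have lenB: "length B = k" "\<forall>b\<in>set B. length b = L" by (auto simp: B_def)
  have "concat (map (\<lambda>s. subsequence y (n + s * L) (n + (s + 1) * L)) [0..<k]) = subsequence y n (n + k * L)"
  proof (induction k)
    case (Suc k)
    have "[n..<n + Suc k * L] = [n..<n + k * L] @ [n + k * L..<n + Suc k * L]"
      using upt_add_eq_append[of n "n + k * L" L] by (simp add: algebra_simps)
    then show ?case using Suc by (simp add: subsequence_def)
  qed simp
  then have catB: "concat B = subsequence y n (n + k * L)" by (simp add: B_def)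
  have uniq: "bs = B" if "length bs = k" "\<forall>b\<in>set bs. length b = L" "concat bs = concat B" for bs
  proof (rule concat_injective[OF that(3)])
    show "length bs = length B" using that(1) lenB(1) by simp
    show "\<forall>(b, c)\<in>set (zip bs B). length b = length c"
      using that(2) lenB(2) by (metis (mono_tags, lifting) case_prodI2 set_zip_leftD set_zip_rightD)
  qed
  have "anti_power k L (subsequence y n (n + k * L)) \<longleftrightarrow> distinct B"
    unfolding anti_power_def catB[symmetric] using uniq lenB by (blast intro: sym)
  also have "\<dots> \<longleftrightarrow> inj_on (\<lambda>s. subsequence y (n + s * L) (n + (s + 1) * L)) {..<k}"
    unfolding B_def distinct_map by (simp add: atLeast0LessThan)
  finally show ?thesis .
qed

end

theory Submission
  imports Defs
begin

text \<open>
  Fix \<open>K\<close> such that no factor of \<open>x\<close> of length \<open>K m\<^sup>q\<close> has a period \<open>d \<le> m\<^sup>q\<close>: otherwise, as every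
  factor of length two recurs with bounded gaps, all pairs of consecutive \<open>\<sigma>\<^sup>q\<close>-blocks, and hence
  \<open>x\<close>, would have period \<open>d\<close>. So for factors \<open>u\<close>, \<open>v\<close> of lengths \<open>K\<close>, \<open>K + 1\<close> the word \<open>\<sigma>\<^sup>q(u)\<close> has
  at most one occurrence in \<open>\<sigma>\<^sup>q(v)\<close> at an offset \<open>r < m\<^sup>q\<close>, and applying \<open>\<sigma>\<close> multiplies this offset
  by \<open>m\<close>. Since there are finitely many pairs \<open>(u, v)\<close>, there is \<open>q\<^sub>0\<close> such that the offset is always
  divisible by \<open>m\<close> to the power \<open>q - q\<^sub>0\<close>. Consequently equal factors of \<open>x\<close> of length at least a
  constant times \<open>m\<^sup>t\<close> start at positions that are congruent modulo \<open>m\<^sup>t\<close>. If \<open>k \<le> m\<^sup>t\<close> and \<open>L\<close> is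
  coprime to \<open>m\<^sup>t\<close> and large enough, then \<open>k\<close> consecutive blocks of length \<open>L\<close> start at pairwise
  incongruent positions and are therefore distinct.
\<close>

locale aperiodic_uniform_fixed_point =
  fixes \<sigma> :: "'a::finite list \<Rightarrow> 'a list" and m :: nat and x :: "'a word"
  assumes m_ge_1: "m \<ge> 1"
    and subst: "substitution \<sigma>" and unif: "uniform_subst m \<sigma>" and prim: "primitive_subst \<sigma>"
    and fixpt: "fixed_point \<sigma> x" and aper: "aperiodic x"
begin

section \<open>Block structure of the fixed point\<close>

lemma not_periodic:
  assumes "d \<ge> 1"
  shows "\<exists>p. x (p + d) \<noteq> x p"
  using aper assms unfolding aperiodic_def eventually_periodic_def by blast

text \<open>If \<open>m = 1\<close>, iterates of \<open>\<sigma>\<close> map letters to single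
  letters, so primitivity leaves only one letter and \<open>x\<close> is constant.\<close>

lemma m_ge_2: "m \<ge> 2"
proof (rule ccontr)
  assume "\<not> m \<ge> 2"
  then have m1: "m = 1" using m_ge_1 by simp
  obtain N where N: "\<And>a b. b \<in> set ((\<sigma> ^^ N) [a])"
    using prim unfolding primitive_subst_def by blast
  have "length ((\<sigma> ^^ N) [a]) = 1" for a
    by (simp add: length_uniform_subst_funpow[OF subst unif] m1)
  then have "\<exists>c. (\<sigma> ^^ N) [a] = [c]" for a
    by (metis One_nat_def length_0_conv length_Suc_conv)
  then have "b = c" for b c :: 'a
    using N by (metis empty_iff insert_iff list.simps(15) set_empty)
  then show False using not_periodic[of 1] by blast
qed

lemma m_pow_pos: "m ^ q > 0"
  using m_ge_1 by simp

lemma nth_block: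
  assumes "r < m ^ q"
  shows "x (m ^ q * a + r) = (\<sigma> ^^ q) [x a] ! r"
proof -
  have "prefix (m ^ q * Suc a) x = (\<sigma> ^^ q) (prefix (Suc a) x)"
    using fixed_point_prefix[OF subst unif m_ge_1 fixpt] by metis
  also have "prefix (Suc a) x = prefix a x @ [x a]" by (simp add: subsequence_def)
  also have "(\<sigma> ^^ q) \<dots> = (\<sigma> ^^ q) (prefix a x) @ (\<sigma> ^^ q) [x a]"
    using substitution_funpow[OF subst] by (simp only: substitution_def)
  also have "(\<sigma> ^^ q) (prefix a x) = prefix (m ^ q * a) x"
    by (rule fixed_point_prefix[OF subst unif m_ge_1 fixpt])
  finally have eq: "prefix (m ^ q * Suc a) x = prefix (m ^ q * a) x @ (\<sigma> ^^ q) [x a]" .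
  have "x (m ^ q * a + r) = prefix (m ^ q * Suc a) x ! (m ^ q * a + r)"
    using assms by simp
  also have "\<dots> = (\<sigma> ^^ q) [x a] ! r"
    unfolding eq by (simp add: nth_append)
  finally show ?thesis .
qed

text \<open>\<open>x\<close> is also fixed by \<open>\<sigma> ^^ q\<close>, so position
  \<open>m ^ q * a\<close> starts the image of the letter \<open>x a\<close>, and equal letters have
  equal images.\<close>

lemma lift_equal_factors:
  assumes eq: "\<And>s. s < l \<Longrightarrow> x (a + s) = x (b + s)" and r: "r < l * m ^ q"
  shows "x (m ^ q * a + r) = x (m ^ q * b + r)"
proof -
  define s t where "s = r div m ^ q" and "t = r mod m ^ q"
  have rst: "r = m ^ q * s + t" by (simp add: s_def t_def)
  have t: "t < m ^ q" using m_pow_pos by (simp add: t_def)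
  have "s < l" using r m_pow_pos unfolding s_def by (simp add: less_mult_imp_div_less)
  then show ?thesis
    using nth_block[OF t, of "a + s"] nth_block[OF t, of "b + s"] eq
    by (simp add: rst algebra_simps)
qed

section \<open>Uniform recurrence of letters and of pairs of letters\<close>

text \<open>By primitivity every block of length \<open>m ^ N\<close> contains all letters; the
  first block starting after \<open>i\<close> ends within two block lengths.\<close>

lemma letters_bounded_gaps: "\<exists>G. \<forall>b i. \<exists>j. i \<le> j \<and> j < i + G \<and> x j = b"
proof -
  obtain N where N: "\<And>a b. b \<in> set ((\<sigma> ^^ N) [a])"
    using prim unfolding primitive_subst_def by blast
  have "\<exists>j. i \<le> j \<and> j < i + 2 * m ^ N \<and> x j = b" for b i
  proof -
    define i' where "i' = i div m ^ N + 1"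
    obtain r where r: "r < length ((\<sigma> ^^ N) [x i'])" "(\<sigma> ^^ N) [x i'] ! r = b"
      using N by (metis in_set_conv_nth)
    then have rm: "r < m ^ N"
      by (simp add: length_uniform_subst_funpow[OF subst unif])
    have "i = m ^ N * (i div m ^ N) + i mod m ^ N" by simp
    moreover have "i mod m ^ N < m ^ N" using m_pow_pos by simp
    moreover have "m ^ N * i' = m ^ N * (i div m ^ N) + m ^ N" by (simp add: i'_def)
    ultimately have "i \<le> m ^ N * i' + r" "m ^ N * i' + r < i + 2 * m ^ N"
      using rm by linarith+
    then show ?thesis using nth_block[OF rm] r by metis
  qed
  then show ?thesis by blast
qed

text \<open>Finitely many positions represent all pairs, so some prefix, the image of
  \<open>x 0\<close> under \<open>\<sigma> ^^ e\<close>, contains every pair; it recurs wherever the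
  letter \<open>x 0\<close> does.\<close>

lemma pairs_bounded_gaps:
  "\<exists>G. \<forall>p i. \<exists>j. i \<le> j \<and> j < i + G \<and> x j = x p \<and> x (j + 1) = x (p + 1)"
proof -
  obtain G where G: "\<And>b i. \<exists>j. i \<le> j \<and> j < i + G \<and> x j = b"
    using letters_bounded_gaps by blast
  define pair where "pair = (\<lambda>p. (x p, x (p + 1)))"
  have "finite (range pair)" by (rule finite_subset[OF subset_UNIV]) simp
  then have "\<exists>D. finite D \<and> range pair = pair ` D"
    using finite_subset_image[of "range pair" pair UNIV] by auto
  then obtain D where D: "finite D" "range pair = pair ` D" by blast
  obtain P where P: "\<And>p. p \<in> D \<Longrightarrow> p < P"
    using D(1) unfolding finite_nat_set_iff_bounded by auto
  \<comment> \<open>Large enough that positions \<open>p'\<close> and \<open>p' + 1\<close> lie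
    below \<open>m ^ e\<close> for all \<open>p'\<close> in \<open>D\<close>.\<close>
  define e where "e = P + 1"
  have "e < 2 ^ e" by (rule less_exp)
  also have "(2::nat) ^ e \<le> m ^ e" by (rule power_mono[OF m_ge_2]) simp
  finally have e: "P + 1 < m ^ e" by (simp add: e_def)
  have "\<exists>j. i \<le> j \<and> j < i + m ^ e * (G + 2) \<and> x j = x p \<and> x (j + 1) = x (p + 1)" for p i
  proof -
    obtain p' where p': "p' \<in> D" "pair p = pair p'" using D(2) by blast
    define i' where "i' = i div m ^ e + 1"
    obtain j where j: "i' \<le> j" "j < i' + G" "x j = x 0" using G by blast
    have "x (m ^ e * j + r) = x r" if "r < m ^ e" for r
      using lift_equal_factors[of 1 j 0 r e] j(3) that by simp
    from this[of p'] this[of "p' + 1"]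
    have eq: "x (m ^ e * j + p') = x p \<and> x (m ^ e * j + p' + 1) = x (p + 1)"
      using P[OF p'(1)] e p'(2) by (simp add: pair_def)
    have "m ^ e * i' \<le> m ^ e * j" using j by simp
    moreover have "m ^ e * j \<le> m ^ e * (i' + G)" using j by simp
    moreover have "i = m ^ e * (i div m ^ e) + i mod m ^ e" by simp
    moreover have "i mod m ^ e < m ^ e" using m_pow_pos by simp
    moreover have "m ^ e * i' = m ^ e * (i div m ^ e) + m ^ e" by (simp add: i'_def)
    moreover have "m ^ e * (i' + G) = m ^ e * i' + m ^ e * G" by (simp add: algebra_simps)
    moreover have "m ^ e * (G + 2) = m ^ e * G + 2 * m ^ e" by (simp add: algebra_simps)
    ultimately have "i \<le> m ^ e * j + p'" "m ^ e * j + p' < i + m ^ e * (G + 2)"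
      using P[OF p'(1)] e by linarith+
    then show ?thesis using eq by blast
  qed
  then show ?thesis by blast
qed

section \<open>Absence of long periods, and recognizability\<close>

lemma no_long_period:
  "\<exists>K. \<forall>q d i. 1 \<le> d \<longrightarrow> d \<le> m ^ q \<longrightarrow> (\<exists>r < K * m ^ q. x (i + r + d) \<noteq> x (i + r))"
proof -
  obtain G where G: "\<And>p i. \<exists>j. i \<le> j \<and> j < i + G \<and> x j = x p \<and> x (j + 1) = x (p + 1)"
    using pairs_bounded_gaps by blast
  have "\<exists>r < (G + 2) * m ^ q. x (i + r + d) \<noteq> x (i + r)" if d: "1 \<le> d" "d \<le> m ^ q" for q d i
  proof (rule ccontr)
    assume "\<not> ?thesis"
    then have per: "x (i + r + d) = x (i + r)" if "r < (G + 2) * m ^ q" for r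
      using that by blast
    have "x (p + d) = x p" for p
    proof -
      define a r where "a = p div m ^ q" and "r = p mod m ^ q"
      have p: "p = m ^ q * a + r" by (simp add: a_def r_def)
      have r: "r < m ^ q" using m_pow_pos by (simp add: r_def)
      define i' where "i' = i div m ^ q + 1"
      obtain j where j: "i' \<le> j" "j < i' + G" "x j = x a" "x (j + 1) = x (a + 1)" using G by blast
      \<comment> \<open>Two blocks are copied because \<open>r + d\<close> may pass the end of the
        first, but stays below \<open>2 * m ^ q\<close>.\<close>
      have aj: "x (m ^ q * a + s) = x (m ^ q * j + s)" if "s < 2 * m ^ q" for s
      proof (rule lift_equal_factors[of 2, OF _ that])
        fix s :: nat assume "s < 2"
        then show "x (a + s) = x (j + s)" using j by (auto simp: less_2_cases_iff)
      qed
      have "m ^ q * i' \<le> m ^ q * j" using j by simp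
      moreover have "m ^ q * j \<le> m ^ q * (i' + G)" using j by simp
      moreover have "i = m ^ q * (i div m ^ q) + i mod m ^ q" by simp
      moreover have "i mod m ^ q < m ^ q" using m_pow_pos by simp
      moreover have "m ^ q * i' = m ^ q * (i div m ^ q) + m ^ q" by (simp add: i'_def)
      moreover have "m ^ q * (i' + G) = m ^ q * i' + m ^ q * G" by (simp add: algebra_simps)
      moreover have "(G + 2) * m ^ q = m ^ q * G + 2 * m ^ q" by (simp add: algebra_simps)
      ultimately have "i \<le> m ^ q * j + r" "m ^ q * j + r - i < (G + 2) * m ^ q"
        using r by linarith+
      then have "x (m ^ q * j + r + d) = x (m ^ q * j + r)"
        using per[of "m ^ q * j + r - i"] by simp
      then show ?thesis
        using aj[of r] aj[of "r + d"] r d by (simp add: p add.assoc)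
    qed
    then show False using not_periodic[OF d(1)] by blast
  qed
  then show ?thesis by blast
qed

lemma recognizability:
  "\<exists>M. \<forall>t i j. (\<forall>s < M * m ^ t. x (i + s) = x (j + s)) \<longrightarrow> i mod m ^ t = j mod m ^ t"
proof -
  obtain K where K: "\<And>q d i. 1 \<le> d \<Longrightarrow> d \<le> m ^ q \<Longrightarrow> \<exists>r < K * m ^ q. x (i + r + d) \<noteq> x (i + r)"
    using no_long_period by blast
  \<comment> \<open>The image of \<open>u\<close> under \<open>\<sigma> ^^ q\<close> occurs in that
    of \<open>v\<close> at offset \<open>r\<close>; the extra letter of \<open>v\<close> makes room
    for the offset. By \<open>lift_equal_factors\<close> the choice of \<open>i\<close> and
    \<open>j\<close> is immaterial.\<close>
  define occ where "occ = (\<lambda>u v q r. r < m ^ q \<and>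
    (\<exists>i j. u = subsequence x i (i + K) \<and> v = subsequence x j (j + (K + 1)) \<and>
       (\<forall>s < K * m ^ q. x (m ^ q * i + s) = x (m ^ q * j + r + s))))"
  have factor_nth: "x (i + s) = x (i' + s)"
    if "subsequence x i (i + l) = subsequence x i' (i' + l)" "s < l" for i i' l s
    using arg_cong[OF that(1), of "\<lambda>w. w ! s"] that(2) by simp
  have occ_unique: "r' \<le> r" if "occ u v q r" "occ u v q r'" for u v q r r'
  proof (rule ccontr)
    assume "\<not> r' \<le> r"
    then have rr': "r < r'" by simp
    obtain i j where ij: "u = subsequence x i (i + K)" "v = subsequence x j (j + (K + 1))"
      "\<And>s. s < K * m ^ q \<Longrightarrow> x (m ^ q * i + s) = x (m ^ q * j + r + s)" and r: "r < m ^ q"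
      using \<open>occ u v q r\<close> unfolding occ_def by blast
    obtain i' j' where ij': "u = subsequence x i' (i' + K)" "v = subsequence x j' (j' + (K + 1))"
      "\<And>s. s < K * m ^ q \<Longrightarrow> x (m ^ q * i' + s) = x (m ^ q * j' + r' + s)" and r': "r' < m ^ q"
      using \<open>occ u v q r'\<close> unfolding occ_def by blast
    have ii': "x (i + s) = x (i' + s)" if "s < K" for s
      using factor_nth[OF _ that] ij(1) ij'(1) by metis
    have jj': "x (j + s) = x (j' + s)" if "s < K + 1" for s
      using factor_nth[OF _ that] ij(2) ij'(2) by metis
    \<comment> \<open>Two occurrences of the same image overlap with shift \<open>r' - r\<close>,
      which is thus a period forbidden by the choice of \<open>K\<close>.\<close>
    have "x (m ^ q * j + r + s + (r' - r)) = x (m ^ q * j + r + s)" if s: "s < K * m ^ q" for s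
    proof -
      have "x (m ^ q * j + (r' + s)) = x (m ^ q * j' + (r' + s))"
        using r' s by (intro lift_equal_factors[of "K + 1", OF jj']) auto
      also have "\<dots> = x (m ^ q * i' + s)" using ij'(3)[OF s] by (simp add: add.assoc)
      also have "\<dots> = x (m ^ q * i + s)"
        using lift_equal_factors[of K i i' s q, OF ii' s] by (rule sym)
      also have "\<dots> = x (m ^ q * j + r + s)" using ij(3)[OF s] .
      finally show ?thesis using rr' by (simp add: algebra_simps)
    qed
    moreover have "1 \<le> r' - r" "r' - r \<le> m ^ q" using rr' r' by simp_all
    ultimately show False using K by blast
  qed
  have occ_scale: "occ u v (q + e) (m ^ e * r)" if o: "occ u v q r" for u v q e r
  proof -
    obtain i j where ij: "u = subsequence x i (i + K)" "v = subsequence x j (j + (K + 1))"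
      "\<And>s. s < K * m ^ q \<Longrightarrow> x (m ^ q * i + s) = x (m ^ q * j + r + s)" and r: "r < m ^ q"
      using o unfolding occ_def by blast
    have "x (m ^ (q + e) * i + s) = x (m ^ (q + e) * j + m ^ e * r + s)"
      if "s < K * m ^ (q + e)" for s
    proof -
      have "x (m ^ e * (m ^ q * i) + s) = x (m ^ e * (m ^ q * j + r) + s)"
        by (rule lift_equal_factors[of "K * m ^ q"])
           (use ij(3) that in \<open>auto simp: power_add mult.assoc\<close>)
      then show ?thesis by (simp add: power_add algebra_simps)
    qed
    moreover have "m ^ e * r < m ^ (q + e)" using r m_pow_pos by (simp add: power_add)
    ultimately show ?thesis using ij(1,2) unfolding occ_def by blast
  qed
  define S where "S = {u :: 'a list. length u = K} \<times> {v :: 'a list. length v = K + 1}"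
  have fin: "finite S"
    unfolding S_def using finite_lists_length_eq[of "UNIV :: 'a set"] by simp
  \<comment> \<open>Some level at which the pair has an occurrence; for pairs without one the value
    is arbitrary and can only enlarge \<open>q0\<close>.\<close>
  define lvl where "lvl = (\<lambda>(u, v). SOME q. \<exists>r. occ u v q r)"
  define q0 where "q0 = Max (insert 0 (lvl ` S))"
  have occ_dvd: "m ^ t dvd r" if o: "occ u v (q0 + t) r" for u v t r
  proof -
    have "(u, v) \<in> S" using o unfolding occ_def S_def by auto
    then have le: "lvl (u, v) \<le> q0" unfolding q0_def using fin by (intro Max_ge) auto
    have "\<exists>r. occ u v (lvl (u, v)) r"
      using someI[of "\<lambda>q. \<exists>r. occ u v q r" "q0 + t"] o unfolding lvl_def by auto
    then obtain r1 where r1: "occ u v (lvl (u, v)) r1" by blast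
    define e where "e = q0 + t - lvl (u, v)"
    have "occ u v (q0 + t) (m ^ e * r1)"
      using occ_scale[OF r1, of e] le by (simp add: e_def)
    \<comment> \<open>The occurrence scaled up from level \<open>lvl (u, v)\<close> must be the
      given one, and \<open>e\<close> is at least \<open>t\<close>.\<close>
    then have "r = m ^ e * r1" using o occ_unique by (meson le_antisym)
    moreover have "m ^ t dvd m ^ e" using le by (intro le_imp_power_dvd) (simp add: e_def)
    ultimately show ?thesis by simp
  qed
  have "i mod m ^ t = j mod m ^ t"
    if eq: "\<And>s. s < (K + 1) * m ^ q0 * m ^ t \<Longrightarrow> x (i + s) = x (j + s)" for t i j
  proof -
    define Q where "Q = m ^ (q0 + t)"
    have Q: "Q > 0" unfolding Q_def by (rule m_pow_pos)
    have eq': "x (i + s) = x (j + s)" if "s < K * Q + Q" for s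
      using eq[of s] that by (simp add: Q_def power_add algebra_simps)
    define i' where "i' = i div Q + 1"
    \<comment> \<open>Shifting both positions by \<open>\<delta>\<close> aligns the first with a
      block boundary. This costs at most \<open>Q\<close> of the common length, leaving
      \<open>K * Q\<close> for \<open>occ\<close>.\<close>
    define \<delta> where "\<delta> = Q - i mod Q"
    have "i = Q * (i div Q) + i mod Q" by simp
    moreover have "i mod Q < Q" using Q by simp
    moreover have "Q * i' = Q * (i div Q) + Q" by (simp add: i'_def)
    ultimately have i': "i + \<delta> = Q * i'" and \<delta>: "\<delta> \<le> Q" unfolding \<delta>_def by linarith+
    define j' r where "j' = (j + \<delta>) div Q" and "r = (j + \<delta>) mod Q"
    have j': "j + \<delta> = Q * j' + r" by (simp add: j'_def r_def)
    have "x (Q * i' + s) = x (Q * j' + r + s)" if "s < K * Q" for s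
    proof -
      have "x (i + (\<delta> + s)) = x (j + (\<delta> + s))" using \<delta> that by (intro eq') linarith
      then show ?thesis by (simp only: add.assoc[symmetric] i' j')
    qed
    moreover have "r < Q" using Q by (simp add: r_def)
    ultimately have "occ (subsequence x i' (i' + K)) (subsequence x j' (j' + (K + 1))) (q0 + t) r"
      unfolding occ_def Q_def by blast
    then have r: "m ^ t dvd r" by (rule occ_dvd)
    have "m ^ t dvd Q" unfolding Q_def by (simp add: power_add)
    then have "m ^ t dvd i + \<delta>" "m ^ t dvd j + \<delta>" unfolding i' j' using r by simp_all
    then obtain a b where "i + \<delta> = m ^ t * a" "j + \<delta> = m ^ t * b" by (elim dvdE)
    then have "i + m ^ t * b = j + m ^ t * a" by linarith
    then show ?thesis unfolding nat_mod_eq_iff by blast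
  qed
  then show ?thesis by blast
qed

section \<open>Anti-powers in the fixed point and their transfer to the subshift\<close>

lemma anti_powers:
  "\<exists>C::nat. \<forall>n k. k \<ge> 1 \<longrightarrow>
     (\<exists>L. 1 \<le> L \<and> L \<le> C * k \<and> anti_power k L (subsequence x n (n + k * L)))"
proof -
  obtain M where M: "\<And>t i j. (\<And>s. s < M * m ^ t \<Longrightarrow> x (i + s) = x (j + s)) \<Longrightarrow> i mod m ^ t = j mod m ^ t"
    using recognizability by blast
  have "\<exists>L. 1 \<le> L \<and> L \<le> (M * m + 1) * k \<and> anti_power k L (subsequence x n (n + k * L))"
    if k: "k \<ge> 1" for n k
  proof -
    have "\<exists>t. k \<le> m ^ t"
    proof
      have "k \<le> 2 ^ k" by (rule less_imp_le[OF less_exp])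
      also have "(2::nat) ^ k \<le> m ^ k" by (rule power_mono[OF m_ge_2]) simp
      finally show "k \<le> m ^ k" .
    qed
    \<comment> \<open>Minimality keeps \<open>m ^ t\<close> at most \<open>m * k\<close>, which
      makes the block length linear in \<open>k\<close>.\<close>
    define t where "t = (LEAST t. k \<le> m ^ t)"
    have t: "k \<le> m ^ t" unfolding t_def by (rule LeastI_ex) fact
    have t': "m ^ t \<le> m * k"
    proof (cases t)
      case 0
      have "1 * 1 \<le> m * k" using m_ge_1 k by (rule mult_le_mono)
      then show ?thesis using 0 by simp
    next
      case (Suc t1)
      then have "t1 < (LEAST t. k \<le> m ^ t)" by (simp add: t_def)
      then have "\<not> k \<le> m ^ t1" by (rule not_less_Least)
      then show ?thesis using Suc by simp
    qed
    \<comment> \<open>Long enough for \<open>M\<close> to apply to equal blocks, while the summand 1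
      makes \<open>L\<close> coprime to \<open>m ^ t\<close>.\<close>
    define L where "L = M * m ^ t + 1"
    have "L \<le> M * (m * k) + 1 * k"
      unfolding L_def using t' k by (intro add_mono mult_le_mono) auto
    then have Lk: "L \<le> (M * m + 1) * k" by (simp add: algebra_simps)
    have cop: "coprime (m ^ t) L"
      unfolding L_def by (rule coprimeI) (metis dvd_add_right_iff dvd_mult)
    have le: "s' \<le> s" if s: "s < k" "s' < k"
      and eq: "subsequence x (n + s * L) (n + (s + 1) * L) = subsequence x (n + s' * L) (n + (s' + 1) * L)"
      for s s'
    proof (rule ccontr)
      assume less: "\<not> s' \<le> s"
      have "(n + s * L) mod m ^ t = (n + s' * L) mod m ^ t"
      proof (rule M)
        fix z assume "z < M * m ^ t"
        then have "z < L" by (simp add: L_def)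
        then show "x (n + s * L + z) = x (n + s' * L + z)"
          using arg_cong[OF eq, of "\<lambda>w. w ! z"] by (simp add: algebra_simps)
      qed
      then have "m ^ t dvd (n + s' * L) - (n + s * L)"
        using less by (intro mod_eq_dvd_iff_nat[THEN iffD1]) auto
      also have "(n + s' * L) - (n + s * L) = (s' - s) * L" by (simp add: diff_mult_distrib)
      finally have "m ^ t dvd s' - s" using cop by (simp add: coprime_dvd_mult_left_iff)
      then have "m ^ t \<le> s' - s" using less by (intro dvd_imp_le) auto
      then show False using t s less by linarith
    qed
    have "inj_on (\<lambda>s. subsequence x (n + s * L) (n + (s + 1) * L)) {..<k}"
    proof (rule inj_onI, unfold lessThan_iff)
      fix s s' assume s: "s < k" "s' < k"
        and eq: "subsequence x (n + s * L) (n + (s + 1) * L) = subsequence x (n + s' * L) (n + (s' + 1) * L)"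
      show "s = s'"
        by (rule le_antisym[OF le[OF s(2,1) eq[symmetric]] le[OF s eq]])
    qed
    then have "anti_power k L (subsequence x n (n + k * L))"
      by (simp only: anti_power_factor_iff)
    moreover have "1 \<le> L" by (simp add: L_def)
    ultimately show ?thesis using Lk by blast
  qed
  then show ?thesis by blast
qed

end

theorem theorem2:
  fixes \<sigma> :: "'a::finite list \<Rightarrow> 'a list" and m :: nat and x :: "'a word"
  assumes "m \<ge> 1"
    and "substitution \<sigma>" and "uniform_subst m \<sigma>" and "primitive_subst \<sigma>"
    and "fixed_point \<sigma> x" and "aperiodic x"
  shows "\<exists>C::real. \<forall>y\<in>subshift \<sigma>. \<forall>n k :: nat. k \<ge> 1 \<longrightarrow>
           (\<exists>L::nat. 1 \<le> L \<and> real L \<le> C * real k \<and> anti_power k L (subsequence y n (n + k * L)))"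
proof -
  interpret aperiodic_uniform_fixed_point \<sigma> m x
    by unfold_locales (fact assms)+
  obtain C where C: "\<And>n k. k \<ge> 1 \<Longrightarrow>
      \<exists>L. 1 \<le> L \<and> L \<le> C * k \<and> anti_power k L (subsequence x n (n + k * L))"
    using anti_powers by blast
  have "\<exists>L. 1 \<le> L \<and> real L \<le> real C * real k \<and> anti_power k L (subsequence y n (n + k * L))"
    if y: "y \<in> subshift \<sigma>" and k: "k \<ge> 1" for y n k
  proof -
    \<comment> \<open>\<open>L\<close> depends on where the prefix of \<open>y\<close> occurs in
      \<open>x\<close>, so the prefix must be long enough for every admissible
      \<open>L\<close>.\<close>
    define b where "b = n + k * (C * k)"
    have "y \<in> orbit_closure x" using y subshift_eq_orbit_closure assms by metis
    then obtain j where j: "prefix b y = subsequence x j (j + b)"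
      unfolding in_orbit_closure_iff by blast
    have nth: "y i = x (j + i)" if "i < b" for i
      using arg_cong[OF j, of "\<lambda>w. w ! i"] that by simp
    obtain L where L: "1 \<le> L" "L \<le> C * k" "anti_power k L (subsequence x (j + n) (j + n + k * L))"
      using C[OF k] by blast
    have "k * L \<le> k * (C * k)" using L(2) by simp
    then have "n + i < b" if "i < k * L" for i
      using that unfolding b_def by linarith
    then have "y (n + i) = x (j + n + i)" if "i < k * L" for i
      using nth that by (simp add: add.assoc)
    then have "subsequence y n (n + k * L) = subsequence x (j + n) (j + n + k * L)"
      by (intro nth_equalityI) auto
    then have "anti_power k L (subsequence y n (n + k * L))" using L(3) by simp
    moreover have "real L \<le> real C * real k" using L(2) by (metis of_nat_le_iff of_nat_mult)
    ultimately show ?thesis using L(1) by blast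
  qed
  then show ?thesis by blast
qed

end
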